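(* Let $(\mathcal{A},\mu_{A,0},\alpha_A)$ and $(\mathcal{B},\mu_{B,0},\alpha_B)$ be multiplicative Hom-associative algebras over $\mathbb{K}$, let $\phi:\mathcal{A}\to\mathcal{B}$ be a Hom-associative algebra morphism and let $\Theta_t=(\mu_{A,t},\mu_{B,t},\phi_t)$ be an order $N$ one-parameter formal deformation of $\phi$ ($N\ge1$). Put $$\mathcal{O}b_{\mathcal{A}}(x,y,z)=\sum_{\substack{p+q=N+1\\ p,q>0}}\big(\mu_{A,p}(\mu_{A,q}(x,y),\alpha_A(z))-\mu_{A,p}(\alpha_A(x),\mu_{A,q}(y,z))\big)\quad(x,y,z\in\mathcal{A}),$$ $\mathcal{O}b_{\mathcal{B}}$ given by the same formula on $\mathcal{B}$ (with $\mu_B,\alpha_B$ in place of $\mu_A,\alpha_A$), and, for $x,y\in\mathcal{A}$, $$\mathcal{O}b_\phi(x,y)=\sum_{\substack{p+q=N+1\\ p,q>0}}\big(\mu_{B,p}(\phi_q(x),\phi(y))+\mu_{B,p}(\phi(x),\phi_q(y))\big)-\sum_{\substack{p+q=N+1\\ p,q>0}}\phi_p(\mu_{A,q}(x,y))+\sum_{\substack{p+q=N+1\\ p,q>0}}\mu_{B,0}(\phi_p(x),\phi_q(y))+\sum_{\substack{p+q+k=N+1\\ p,q,k>0}}\mu_{B,p}(\phi_q(x),\phi_k(y)).$$ Then $\mathcal{O}b=(\mathcal{O}b_{\mathcal{A}},\mathcal{O}b_{\mathcal{B}},\mathcal{O}b_\phi)\in Z^3_{Hom}(\phi,\phi)$.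 Therefore the deformation $\Theta_t$ extends to a deformation of order $N+1$ if and only if $\mathcal{O}b$ is a coboundary, i.e. $\mathcal{O}b\in B^3_{Hom}(\phi,\phi)$.
   Context: $\mathbb{K}$ is an algebraically closed field of characteristic $0$. A Hom-associative algebra $(\mathcal{A},\mu,\alpha)$ is a vector space with a bilinear map $\mu$ and a linear map $\alpha$ such that $\mu(\alpha(x),\mu(y,z))=\mu(\mu(x,y),\alpha(z))$; it is multiplicative if $\alpha\circ\mu=\mu\circ(\alpha\otimes\alpha)$. A morphism $\phi:\mathcal{A}\to\mathcal{B}$ is a linear map with $\mu_{B,0}\circ(\phi\otimes\phi)=\phi\circ\mu_{A,0}$ and $\phi\circ\alpha_A=\alpha_B\circ\phi$. Cohomology: for $n\ge1$, $C^n_{\alpha_A,\alpha_B}(\mathcal{A},\mathcal{B})$ is the space of $n$-linear maps $f:\mathcal{A}^{\times n}\to\mathcal{B}$ with $\alpha_B(f(u_1,\dots,u_n))=f(\alpha_A(u_1),\dots,\alpha_A(u_n))$, with $$\delta^n_{Hom}\varphi(x_0,\dots,x_n)=\mu_{B,0}(\phi(\alpha_A^{n-1}(x_0)),\varphi(x_1,\dots,x_n))+\sum_{k=1}^n(-1)^k\varphi(\alpha_A(x_0),\dots,\alpha_A(x_{k-2}),\mu_{A,0}(x_{k-1},x_k),\alpha_A(x_{k+1}),\dots,\alpha_A(x_n))+(-1)^{n+1}\mu_{B,0}(\varphi(x_0,\dots,x_{n-1}),\phi(\alpha_A^{n-1}(x_n))).$$ $C^n_{Hom}(\mathcal{A},\mathcal{A})$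 and $C^n_{Hom}(\mathcal{B},\mathcal{B})$ with their $\delta^n_{Hom}$ are the case $\phi=\mathrm{id}$. For $n\ge2$, $C^n_{Hom}(\phi,\phi)=C^n_{Hom}(\mathcal{A},\mathcal{A})\times C^n_{Hom}(\mathcal{B},\mathcal{B})\times C^{n-1}_{\alpha_A,\alpha_B}(\mathcal{A},\mathcal{B})$ and $\delta^n(\varphi_1,\varphi_2,\varphi_3)=(\delta^n_{Hom}\varphi_1,\delta^n_{Hom}\varphi_2,\phi\circ\varphi_1-\varphi_2\circ\phi^{\otimes n}-\delta^{n-1}_{Hom}\varphi_3)$. $Z^3_{Hom}(\phi,\phi)=\ker\delta^3$, $B^3_{Hom}(\phi,\phi)=\mathrm{im}\,\delta^2$. Deformations of order $N$: a triple $\Theta_t=(\mu_{A,t},\mu_{B,t},\phi_t)$ with $\mu_{A,t}=\sum_{i=0}^N\mu_{A,i}t^i$, $\mu_{B,t}=\sum_{i=0}^N\mu_{B,i}t^i$, $\phi_t=\sum_{i=0}^N\phi_it^i$, $\phi_0=\phi$, where $\mu_{A,i}$, $\mu_{B,i}$ are bilinear maps on $\mathcal{A}$, $\mathcal{B}$ commuting with $\alpha_A$, $\alpha_B$ respectively (i.e. in $C^2_{Hom}$), $\phi_i:\mathcal{A}\to\mathcal{B}$ are linear with $\phi_i\circ\alpha_A=\alpha_B\circ\phi_i$, such that for every $0\le n\le N$: $\sum_{i+j=n}\big(\mu_{A,i}(\mu_{A,j}(x,y),\alpha_A(z))-\mu_{A,i}(\alpha_A(x),\mu_{A,j}(y,z))\big)=0$,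 the same for $\mathcal{B}$, and $\sum_{i=0}^n\phi_i(\mu_{A,n-i}(a,b))=\sum_{i+j+k=n}\mu_{B,i}(\phi_j(a),\phi_k(b))$. It extends to order $N+1$ if there is a $2$-cochain $\theta_{N+1}=(\mu_{A,N+1},\mu_{B,N+1},\phi_{N+1})\in C^2_{Hom}(\phi,\phi)$ such that $\Theta_t+t^{N+1}\theta_{N+1}$ is a deformation of order $N+1$. *)

theory Defs
  imports Complex_Main "HOL-Computational_Algebra.Polynomial"
begin

text \<open>
  An algebra with a twisting map lives on a whole type of class \<open>ab_group_add\<close>; the vector space
  structure is the scalar multiplication \<open>scal\<close>. The record carries no axioms.
\<close>

record ('k, 'a) hom_alg =
  scal :: "'k \<Rightarrow> 'a \<Rightarrow> 'a"
  mult :: "'a \<Rightarrow> 'a \<Rightarrow> 'a"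
  twist :: "'a \<Rightarrow> 'a"

definition hom_associative :: "('k::field, 'a::ab_group_add) hom_alg \<Rightarrow> bool" where
  "hom_associative A \<longleftrightarrow>
     vector_space (scal A) \<and>
     (\<forall>x. Vector_Spaces.linear (scal A) (scal A) (\<lambda>y. mult A x y)) \<and>
     (\<forall>y. Vector_Spaces.linear (scal A) (scal A) (\<lambda>x. mult A x y)) \<and>
     Vector_Spaces.linear (scal A) (scal A) (twist A) \<and>
     (\<forall>x y z. mult A (twist A x) (mult A y z) = mult A (mult A x y) (twist A z))"

definition multiplicative :: "('k, 'a) hom_alg \<Rightarrow> bool" where
  "multiplicative A \<longleftrightarrow> (\<forall>x y. twist A (mult A x y) = mult A (twist A x) (twist A y))"

definition hom_alg_morphism ::
  "('k::field, 'a::ab_group_add) hom_alg \<Rightarrow> ('k, 'b::ab_group_add) hom_alg \<Rightarrow> ('a \<Rightarrow> 'b) \<Rightarrow> bool" where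
  "hom_alg_morphism A B \<phi> \<longleftrightarrow>
     Vector_Spaces.linear (scal A) (scal B) \<phi> \<and>
     (\<forall>x y. mult B (\<phi> x) (\<phi> y) = \<phi> (mult A x y)) \<and>
     (\<forall>x. \<phi> (twist A x) = twist B (\<phi> x))"

text \<open>
  An \<open>n\<close>-ary map is encoded as a function on lists. Only its values on lists of length \<open>n\<close> are
  meaningful; a cochain is required to vanish on all other lists, so that equality of cochains is
  equality of functions and the zero cochain is \<open>\<lambda>_. 0\<close>.
\<close>

definition multilinear ::
  "('k::field \<Rightarrow> 'a::ab_group_add \<Rightarrow> 'a) \<Rightarrow> ('k \<Rightarrow> 'b::ab_group_add \<Rightarrow> 'b) \<Rightarrow> nat \<Rightarrow> ('a list \<Rightarrow> 'b) \<Rightarrow> bool" where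
  "multilinear s1 s2 n f \<longleftrightarrow>
     (\<forall>us i. length us = n \<longrightarrow> i < n \<longrightarrow> Vector_Spaces.linear s1 s2 (\<lambda>u. f (us[i := u])))"

definition hom_cochains ::
  "('k::field, 'a::ab_group_add) hom_alg \<Rightarrow> ('k, 'b::ab_group_add) hom_alg \<Rightarrow> nat \<Rightarrow> ('a list \<Rightarrow> 'b) set" where
  "hom_cochains A B n = {f.
     multilinear (scal A) (scal B) n f \<and>
     (\<forall>us. length us = n \<longrightarrow> twist B (f us) = f (map (twist A) us)) \<and>
     (\<forall>us. length us \<noteq> n \<longrightarrow> f us = 0)}"

definition cochain1 :: "('a \<Rightarrow> 'b::zero) \<Rightarrow> 'a list \<Rightarrow> 'b" where
  "cochain1 f us = (case us of [x] \<Rightarrow> f x | _ \<Rightarrow> 0)"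

definition cochain2 :: "('a \<Rightarrow> 'a \<Rightarrow> 'b::zero) \<Rightarrow> 'a list \<Rightarrow> 'b" where
  "cochain2 f us = (case us of [x, y] \<Rightarrow> f x y | _ \<Rightarrow> 0)"

definition cochain3 :: "('a \<Rightarrow> 'a \<Rightarrow> 'a \<Rightarrow> 'b::zero) \<Rightarrow> 'a list \<Rightarrow> 'b" where
  "cochain3 f us = (case us of [x, y, z] \<Rightarrow> f x y z | _ \<Rightarrow> 0)"

text \<open>
  The list \<open>xs\<close> is \<open>[x\<^sub>0, \<dots>, x\<^sub>n]\<close>; in the \<open>k\<close>-th summand \<open>take (k - 1) xs\<close> is
  \<open>[x\<^sub>0, \<dots>, x\<^bsub>k-2\<^esub>]\<close>, empty for \<open>k = 1\<close>, and \<open>drop (k + 1) xs\<close> is \<open>[x\<^bsub>k+1\<^esub>, \<dots>, x\<^sub>n]\<close>.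
\<close>

definition hom_delta ::
  "('k::field, 'a::ab_group_add) hom_alg \<Rightarrow> ('k, 'b::ab_group_add) hom_alg \<Rightarrow> ('a \<Rightarrow> 'b) \<Rightarrow>
     nat \<Rightarrow> ('a list \<Rightarrow> 'b) \<Rightarrow> 'a list \<Rightarrow> 'b" where
  "hom_delta A B \<phi> n f xs =
     (if length xs = n + 1 then
        mult B (\<phi> ((twist A ^^ (n - 1)) (xs ! 0))) (f (tl xs))
        + (\<Sum>k = 1..n. scal B ((-1) ^ k)
             (f (map (twist A) (take (k - 1) xs)
                 @ [mult A (xs ! (k - 1)) (xs ! k)]
                 @ map (twist A) (drop (k + 1) xs))))
        + scal B ((-1) ^ (n + 1))
            (mult B (f (butlast xs)) (\<phi> ((twist A ^^ (n - 1)) (xs ! n))))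
      else 0)"

text \<open>The complex of a morphism \<open>\<phi>\<close>; its cochains and differential are meant for \<open>n \<ge> 2\<close>.\<close>

type_synonym ('a, 'b) triple = "('a list \<Rightarrow> 'a) \<times> ('b list \<Rightarrow> 'b) \<times> ('a list \<Rightarrow> 'b)"

definition mor_cochains ::
  "('k::field, 'a::ab_group_add) hom_alg \<Rightarrow> ('k, 'b::ab_group_add) hom_alg \<Rightarrow> nat \<Rightarrow> ('a, 'b) triple set" where
  "mor_cochains A B n = hom_cochains A A n \<times> hom_cochains B B n \<times> hom_cochains A B (n - 1)"

definition mor_delta ::
  "('k::field, 'a::ab_group_add) hom_alg \<Rightarrow> ('k, 'b::ab_group_add) hom_alg \<Rightarrow> ('a \<Rightarrow> 'b) \<Rightarrow>
     nat \<Rightarrow> ('a, 'b) triple \<Rightarrow> ('a, 'b) triple" where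
  "mor_delta A B \<phi> n = (\<lambda>(f\<^sub>1, f\<^sub>2, f\<^sub>3).
     (hom_delta A A id n f\<^sub>1,
      hom_delta B B id n f\<^sub>2,
      \<lambda>xs. \<phi> (f\<^sub>1 xs) - f\<^sub>2 (map \<phi> xs) - hom_delta A B \<phi> (n - 1) f\<^sub>3 xs))"

definition mor_cocycles ::
  "('k::field, 'a::ab_group_add) hom_alg \<Rightarrow> ('k, 'b::ab_group_add) hom_alg \<Rightarrow> ('a \<Rightarrow> 'b) \<Rightarrow>
     nat \<Rightarrow> ('a, 'b) triple set" where
  "mor_cocycles A B \<phi> n =
     {c \<in> mor_cochains A B n. mor_delta A B \<phi> n c = (\<lambda>_. 0, \<lambda>_. 0, \<lambda>_. 0)}"

text \<open>Meant for \<open>n \<ge> 3\<close>.\<close>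

definition mor_coboundaries ::
  "('k::field, 'a::ab_group_add) hom_alg \<Rightarrow> ('k, 'b::ab_group_add) hom_alg \<Rightarrow> ('a \<Rightarrow> 'b) \<Rightarrow>
     nat \<Rightarrow> ('a, 'b) triple set" where
  "mor_coboundaries A B \<phi> n = mor_delta A B \<phi> (n - 1) ` mor_cochains A B (n - 1)"

text \<open>
  The polynomials \<open>\<mu>\<^bsub>A,t\<^esub>\<close>, \<open>\<mu>\<^bsub>B,t\<^esub>\<close>, \<open>\<phi>\<^sub>t\<close> of degree at most \<open>N\<close> are given by their coefficient
  sequences \<open>\<mu>A\<close>, \<open>\<mu>B\<close>, \<open>\<phi>s\<close>, which vanish above \<open>N\<close>.
\<close>

definition deformation_of_order ::
  "('k::field, 'a::ab_group_add) hom_alg \<Rightarrow> ('k, 'b::ab_group_add) hom_alg \<Rightarrow> ('a \<Rightarrow> 'b) \<Rightarrow> nat \<Rightarrow>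
     (nat \<Rightarrow> 'a \<Rightarrow> 'a \<Rightarrow> 'a) \<Rightarrow> (nat \<Rightarrow> 'b \<Rightarrow> 'b \<Rightarrow> 'b) \<Rightarrow> (nat \<Rightarrow> 'a \<Rightarrow> 'b) \<Rightarrow> bool" where
  "deformation_of_order A B \<phi> N \<mu>A \<mu>B \<phi>s \<longleftrightarrow>
     \<mu>A 0 = mult A \<and> \<mu>B 0 = mult B \<and> \<phi>s 0 = \<phi> \<and>
     (\<forall>i\<le>N. cochain2 (\<mu>A i) \<in> hom_cochains A A 2 \<and>
            cochain2 (\<mu>B i) \<in> hom_cochains B B 2 \<and>
            cochain1 (\<phi>s i) \<in> hom_cochains A B 1) \<and>
     (\<forall>i>N. \<mu>A i = (\<lambda>_ _. 0) \<and> \<mu>B i = (\<lambda>_ _. 0) \<and> \<phi>s i = (\<lambda>_. 0)) \<and>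
     (\<forall>n\<le>N.
        (\<forall>x y z. (\<Sum>(i, j) \<in> {(i, j). i + j = n}.
            \<mu>A i (\<mu>A j x y) (twist A z) - \<mu>A i (twist A x) (\<mu>A j y z)) = 0) \<and>
        (\<forall>x y z. (\<Sum>(i, j) \<in> {(i, j). i + j = n}.
            \<mu>B i (\<mu>B j x y) (twist B z) - \<mu>B i (twist B x) (\<mu>B j y z)) = 0) \<and>
        (\<forall>a b. (\<Sum>i = 0..n. \<phi>s i (\<mu>A (n - i) a b)) =
            (\<Sum>(i, j, k) \<in> {(i, j, k). i + j + k = n}. \<mu>B i (\<phi>s j a) (\<phi>s k b))))"

text \<open>
  Since the coefficients of a deformation of order \<open>N\<close> vanish above \<open>N\<close>, adding \<open>t\<^bsup>N+1\<^esup>\<theta>\<close> amounts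
  to updating the coefficient with index \<open>N + 1\<close>.
\<close>

definition extends_to_next_order ::
  "('k::field, 'a::ab_group_add) hom_alg \<Rightarrow> ('k, 'b::ab_group_add) hom_alg \<Rightarrow> ('a \<Rightarrow> 'b) \<Rightarrow> nat \<Rightarrow>
     (nat \<Rightarrow> 'a \<Rightarrow> 'a \<Rightarrow> 'a) \<Rightarrow> (nat \<Rightarrow> 'b \<Rightarrow> 'b \<Rightarrow> 'b) \<Rightarrow> (nat \<Rightarrow> 'a \<Rightarrow> 'b) \<Rightarrow> bool" where
  "extends_to_next_order A B \<phi> N \<mu>A \<mu>B \<phi>s \<longleftrightarrow>
     (\<exists>m\<^sub>A m\<^sub>B \<psi>. (cochain2 m\<^sub>A, cochain2 m\<^sub>B, cochain1 \<psi>) \<in> mor_cochains A B 2 \<and>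
        deformation_of_order A B \<phi> (N + 1) (\<mu>A(N + 1 := m\<^sub>A)) (\<mu>B(N + 1 := m\<^sub>B)) (\<phi>s(N + 1 := \<psi>)))"

definition ob_alg ::
  "('k, 'a::ab_group_add) hom_alg \<Rightarrow> nat \<Rightarrow> (nat \<Rightarrow> 'a \<Rightarrow> 'a \<Rightarrow> 'a) \<Rightarrow> 'a \<Rightarrow> 'a \<Rightarrow> 'a \<Rightarrow> 'a" where
  "ob_alg A N \<mu> x y z =
     (\<Sum>(p, q) \<in> {(p, q). p + q = N + 1 \<and> p > 0 \<and> q > 0}.
        \<mu> p (\<mu> q x y) (twist A z) - \<mu> p (twist A x) (\<mu> q y z))"

definition ob_mor ::
  "('k, 'b::ab_group_add) hom_alg \<Rightarrow> ('a \<Rightarrow> 'b) \<Rightarrow> nat \<Rightarrow>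
     (nat \<Rightarrow> 'a \<Rightarrow> 'a \<Rightarrow> 'a) \<Rightarrow> (nat \<Rightarrow> 'b \<Rightarrow> 'b \<Rightarrow> 'b) \<Rightarrow> (nat \<Rightarrow> 'a \<Rightarrow> 'b) \<Rightarrow> 'a \<Rightarrow> 'a \<Rightarrow> 'b" where
  "ob_mor B \<phi> N \<mu>A \<mu>B \<phi>s x y =
     (\<Sum>(p, q) \<in> {(p, q). p + q = N + 1 \<and> p > 0 \<and> q > 0}.
        \<mu>B p (\<phi>s q x) (\<phi> y) + \<mu>B p (\<phi> x) (\<phi>s q y))
     - (\<Sum>(p, q) \<in> {(p, q). p + q = N + 1 \<and> p > 0 \<and> q > 0}. \<phi>s p (\<mu>A q x y))
     + (\<Sum>(p, q) \<in> {(p, q). p + q = N + 1 \<and> p > 0 \<and> q > 0}. mult B (\<phi>s p x) (\<phi>s q y))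
     + (\<Sum>(p, q, k) \<in> {(p, q, k). p + q + k = N + 1 \<and> p > 0 \<and> q > 0 \<and> k > 0}.
          \<mu>B p (\<phi>s q x) (\<phi>s k y))"

definition obstruction ::
  "('k, 'a::ab_group_add) hom_alg \<Rightarrow> ('k, 'b::ab_group_add) hom_alg \<Rightarrow> ('a \<Rightarrow> 'b) \<Rightarrow> nat \<Rightarrow>
     (nat \<Rightarrow> 'a \<Rightarrow> 'a \<Rightarrow> 'a) \<Rightarrow> (nat \<Rightarrow> 'b \<Rightarrow> 'b \<Rightarrow> 'b) \<Rightarrow> (nat \<Rightarrow> 'a \<Rightarrow> 'b) \<Rightarrow> ('a, 'b) triple" where
  "obstruction A B \<phi> N \<mu>A \<mu>B \<phi>s =
     (cochain3 (ob_alg A N \<mu>A), cochain3 (ob_alg B N \<mu>B), cochain2 (ob_mor B \<phi> N \<mu>A \<mu>B \<phi>s))"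

end

(*
  Let a_n and D_n be the coefficients of t^n in the Hom-associator of mu_t and in the failure
  mu_{B,t} (phi_t, phi_t) - phi_t mu_{A,t} of phi_t to be multiplicative. Two identities hold for
  arbitrary coefficient families that commute with the twists: the pentagon identity for the
  Hom-associator, and the identity expressing phi_t (associator_A) - associator_B (phi_t, phi_t, phi_t)
  through D. In a deformation of order N all a_n and D_n with n <= N vanish, so in degree N + 1 only
  the terms with a_{N+1}, D_{N+1} and coefficients of index 0 survive, and the identities become the
  cocycle condition. Separating in a_{N+1} and D_{N+1} the summands that contain a coefficient of
  index N + 1 gives obstruction minus coboundary of that coefficient; so for the coefficients
  truncated at N they are the obstruction itself, and an extension is a primitive of it.
*)
theory Submission
  imports Defs
begin

section \<open>Finite sums over index tuples with a prescribed total\<close>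

abbreviation pairs :: "nat \<Rightarrow> (nat \<times> nat) set" where
  "pairs n \<equiv> {(i, j). i + j = n}"

abbreviation triples :: "nat \<Rightarrow> (nat \<times> nat \<times> nat) set" where
  "triples n \<equiv> {(i, j, k). i + j + k = n}"

abbreviation quadruples :: "nat \<Rightarrow> (nat \<times> nat \<times> nat \<times> nat) set" where
  "quadruples n \<equiv> {(i, j, k, l). i + j + k + l = n}"

abbreviation quintuples :: "nat \<Rightarrow> (nat \<times> nat \<times> nat \<times> nat \<times> nat) set" where
  "quintuples n \<equiv> {(i, j, k, l, m). i + j + k + l + m = n}"

lemma finite_pairs: "finite (pairs n)"
  by (rule finite_subset[of _ "{..n} \<times> {..n}"]) auto

lemma finite_triples: "finite (triples n)"
  by (rule finite_subset[of _ "{..n} \<times> {..n} \<times> {..n}"]) auto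

lemma finite_quadruples: "finite (quadruples n)"
  by (rule finite_subset[of _ "{..n} \<times> {..n} \<times> {..n} \<times> {..n}"]) auto

lemmas finite_tuples = finite_pairs finite_triples finite_quadruples

lemma sum_triples_swap: "(\<Sum>(i, j, k)\<in>triples n. F i j k) = (\<Sum>(i, j, k)\<in>triples n. F j i k)"
  by (rule sum.reindex_bij_witness[where i = "\<lambda>(i, j, k). (j, i, k)"
      and j = "\<lambda>(i, j, k). (j, i, k)"]) auto

lemma sum_triples_rotate: "(\<Sum>(i, j, k)\<in>triples n. F i j k) = (\<Sum>(i, j, k)\<in>triples n. F j k i)"
  by (rule sum.reindex_bij_witness[where i = "\<lambda>(i, j, k). (j, k, i)"
      and j = "\<lambda>(i, j, k). (k, i, j)"]) auto

text \<open>A summand that binds a tuple is a \<open>case_prod\<close>, under which the plain rule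
  \<open>sum_subtractf\<close> does not match. The versions for pairs, triples and quadruples serve
  as unfolding rules; the same holds for \<open>additive_sum_split2\<close> and
  \<open>additive_sum_split3\<close>.\<close>

lemma sum_subtractf_split2:
  fixes F :: "'i \<Rightarrow> 'j \<Rightarrow> 'a::ab_group_add"
  shows "(\<Sum>(i, j)\<in>A. F i j - G i j) = (\<Sum>(i, j)\<in>A. F i j) - (\<Sum>(i, j)\<in>A. G i j)"
  by (simp add: case_prod_unfold sum_subtractf)

lemma sum_subtractf_split3:
  fixes F :: "'i \<Rightarrow> 'j \<Rightarrow> 'k \<Rightarrow> 'a::ab_group_add"
  shows "(\<Sum>(i, j, k)\<in>A. F i j k - G i j k) = (\<Sum>(i, j, k)\<in>A. F i j k) - (\<Sum>(i, j, k)\<in>A. G i j k)"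
  by (simp add: case_prod_unfold sum_subtractf)

lemma sum_subtractf_split4:
  fixes F :: "'i \<Rightarrow> 'j \<Rightarrow> 'k \<Rightarrow> 'l \<Rightarrow> 'a::ab_group_add"
  shows "(\<Sum>(i, j, k, l)\<in>A. F i j k l - G i j k l)
    = (\<Sum>(i, j, k, l)\<in>A. F i j k l) - (\<Sum>(i, j, k, l)\<in>A. G i j k l)"
  by (simp add: case_prod_unfold sum_subtractf)

lemmas sum_split = sum_subtractf_split2 sum_subtractf_split3 sum_subtractf_split4

lemma additive_sum_split2:
  "additive f \<Longrightarrow> f (\<Sum>(i, j)\<in>A. F i j) = (\<Sum>(i, j)\<in>A. f (F i j))"
  by (simp add: case_prod_unfold additive.sum)

lemma additive_sum_split3:
  "additive f \<Longrightarrow> f (\<Sum>(i, j, k)\<in>A. F i j k) = (\<Sum>(i, j, k)\<in>A. f (F i j k))"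
  by (simp add: case_prod_unfold additive.sum)

text \<open>Decomposing one index further refines the decomposition, as in the associativity of the
  Cauchy product. The tuple patterns are first replaced by projections, so that
  \<open>sum.Sigma\<close> sees an inner index set depending on a single variable. The variants
  below follow the same scheme.\<close>

lemma sum_pairs_pairs:
  "(\<Sum>(i, m)\<in>pairs n. \<Sum>(j, k)\<in>pairs m. F i j k) = (\<Sum>(i, j, k)\<in>triples n. F i j k)"
proof -
  have "(\<Sum>(i, m)\<in>pairs n. \<Sum>(j, k)\<in>pairs m. F i j k)
    = (\<Sum>p\<in>pairs n. \<Sum>q\<in>pairs (snd p). F (fst p) (fst q) (snd q))"
    by (auto intro!: sum.cong)
  also have "\<dots> = (\<Sum>(p, q)\<in>(SIGMA p:pairs n. pairs (snd p)). F (fst p) (fst q) (snd q))"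
    by (intro sum.Sigma ballI finite_tuples)
  also have "\<dots> = (\<Sum>(i, j, k)\<in>triples n. F i j k)"
    by (rule sum.reindex_bij_witness[where i = "\<lambda>(i, j, k). ((i, j + k), (j, k))"
        and j = "\<lambda>((i, m), (j, k)). (i, j, k)"]) auto
  finally show ?thesis .
qed

lemma sum_pairs_triples:
  "(\<Sum>(i, m)\<in>pairs n. \<Sum>(j, k, l)\<in>triples m. F i j k l)
    = (\<Sum>(i, j, k, l)\<in>quadruples n. F i j k l)"
proof -
  have "(\<Sum>(i, m)\<in>pairs n. \<Sum>(j, k, l)\<in>triples m. F i j k l)
    = (\<Sum>p\<in>pairs n. \<Sum>q\<in>triples (snd p). F (fst p) (fst q) (fst (snd q)) (snd (snd q)))"
    by (auto intro!: sum.cong)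
  also have "\<dots>
    = (\<Sum>(p, q)\<in>(SIGMA p:pairs n. triples (snd p)). F (fst p) (fst q) (fst (snd q)) (snd (snd q)))"
    by (intro sum.Sigma ballI finite_tuples)
  also have "\<dots> = (\<Sum>(i, j, k, l)\<in>quadruples n. F i j k l)"
    by (rule sum.reindex_bij_witness[where i = "\<lambda>(i, j, k, l). ((i, j + k + l), (j, k, l))"
        and j = "\<lambda>((i, m), (j, k, l)). (i, j, k, l)"]) auto
  finally show ?thesis .
qed

lemma sum_triples_pairs:
  "(\<Sum>(i, j, m)\<in>triples n. \<Sum>(k, l)\<in>pairs m. F i j k l)
    = (\<Sum>(i, j, k, l)\<in>quadruples n. F i j k l)"
proof -
  have "(\<Sum>(i, j, m)\<in>triples n. \<Sum>(k, l)\<in>pairs m. F i j k l)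
    = (\<Sum>p\<in>triples n. \<Sum>q\<in>pairs (snd (snd p)). F (fst p) (fst (snd p)) (fst q) (snd q))"
    by (auto intro!: sum.cong)
  also have "\<dots>
    = (\<Sum>(p, q)\<in>(SIGMA p:triples n. pairs (snd (snd p))). F (fst p) (fst (snd p)) (fst q) (snd q))"
    by (intro sum.Sigma ballI finite_tuples)
  also have "\<dots> = (\<Sum>(i, j, k, l)\<in>quadruples n. F i j k l)"
    by (rule sum.reindex_bij_witness[where i = "\<lambda>(i, j, k, l). ((i, j, k + l), (k, l))"
        and j = "\<lambda>((i, j, m), (k, l)). (i, j, k, l)"]) auto
  finally show ?thesis .
qed

lemma sum_triples_triples:
  "(\<Sum>(i, j, m)\<in>triples n. \<Sum>(k, l, r)\<in>triples m. F i j k l r)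
    = (\<Sum>(i, j, k, l, r)\<in>quintuples n. F i j k l r)"
proof -
  have "(\<Sum>(i, j, m)\<in>triples n. \<Sum>(k, l, r)\<in>triples m. F i j k l r)
    = (\<Sum>p\<in>triples n. \<Sum>q\<in>triples (snd (snd p)). F (fst p) (fst (snd p)) (fst q) (fst (snd q)) (snd (snd q)))"
    by (auto intro!: sum.cong)
  also have "\<dots>
    = (\<Sum>(p, q)\<in>(SIGMA p:triples n. triples (snd (snd p))). F (fst p) (fst (snd p)) (fst q) (fst (snd q)) (snd (snd q)))"
    by (intro sum.Sigma ballI finite_tuples)
  also have "\<dots> = (\<Sum>(i, j, k, l, r)\<in>quintuples n. F i j k l r)"
    by (rule sum.reindex_bij_witness[where i = "\<lambda>(i, j, k, l, r). ((i, j, k + l + r), (k, l, r))"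
        and j = "\<lambda>((i, j, m), (k, l, r)). (i, j, k, l, r)"]) auto
  finally show ?thesis .
qed

lemma sum_quadruples_pairs:
  "(\<Sum>(m, i, j, k)\<in>quadruples n. \<Sum>(l, r)\<in>pairs m. F l r i j k)
    = (\<Sum>(l, r, i, j, k)\<in>quintuples n. F l r i j k)"
proof -
  have "(\<Sum>(m, i, j, k)\<in>quadruples n. \<Sum>(l, r)\<in>pairs m. F l r i j k)
    = (\<Sum>p\<in>quadruples n. \<Sum>q\<in>pairs (fst p). F (fst q) (snd q) (fst (snd p)) (fst (snd (snd p))) (snd (snd (snd p))))"
    by (auto intro!: sum.cong)
  also have "\<dots>
    = (\<Sum>(p, q)\<in>(SIGMA p:quadruples n. pairs (fst p)). F (fst q) (snd q) (fst (snd p)) (fst (snd (snd p))) (snd (snd (snd p))))"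
    by (intro sum.Sigma ballI finite_tuples)
  also have "\<dots> = (\<Sum>(l, r, i, j, k)\<in>quintuples n. F l r i j k)"
    by (rule sum.reindex_bij_witness[where i = "\<lambda>(l, r, i, j, k). ((l + r, i, j, k), (l, r))"
        and j = "\<lambda>((m, i, j, k), (l, r)). (l, r, i, j, k)"]) auto
  finally show ?thesis .
qed

text \<open>In the applications \<open>F i m\<close> contains an associator or a defect of degree
  \<open>m\<close>, which vanishes for \<open>m\<close> up to \<open>N\<close>. A total of
  \<open>Suc N\<close> then forces \<open>m = Suc N\<close>, and all remaining indices are
  0.\<close>

lemma sum_pairs_top:
  assumes "\<And>i m. m \<le> N \<Longrightarrow> F i m = 0"
  shows "(\<Sum>(i, m)\<in>pairs (Suc N). F i m) = F 0 (Suc N)"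
proof -
  have "(\<Sum>(i, m)\<in>pairs (Suc N). F i m) = (\<Sum>(i, m)\<in>{(0, Suc N)}. F i m)"
    by (intro sum.mono_neutral_right finite_tuples) (auto simp: assms intro: ccontr)
  then show ?thesis by simp
qed

lemma sum_triples_top:
  assumes "\<And>i j m. m \<le> N \<Longrightarrow> F i j m = 0"
  shows "(\<Sum>(i, j, m)\<in>triples (Suc N). F i j m) = F 0 0 (Suc N)"
proof -
  have "(\<Sum>(i, j, m)\<in>triples (Suc N). F i j m) = (\<Sum>(i, j, m)\<in>{(0, 0, Suc N)}. F i j m)"
    by (intro sum.mono_neutral_right finite_tuples) (auto simp: assms intro: ccontr)
  then show ?thesis by simp
qed

lemma sum_quadruples_top:
  assumes "\<And>m i j k. m \<le> N \<Longrightarrow> F m i j k = 0"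
  shows "(\<Sum>(m, i, j, k)\<in>quadruples (Suc N). F m i j k) = F (Suc N) 0 0 0"
proof -
  have "(\<Sum>(m, i, j, k)\<in>quadruples (Suc N). F m i j k)
    = (\<Sum>(m, i, j, k)\<in>{(Suc N, 0, 0, 0)}. F m i j k)"
    by (intro sum.mono_neutral_right finite_tuples) (auto simp: assms intro: ccontr)
  then show ?thesis by simp
qed

text \<open>The two boundary pairs are the ones in which a coefficient of index \<open>N + 1\<close>
  occurs; the remaining sum has the index set of the obstruction.\<close>

lemma sum_pairs_outer:
  fixes F :: "nat \<Rightarrow> nat \<Rightarrow> 'a::ab_group_add"
  shows "(\<Sum>(i, j)\<in>pairs (Suc N). F i j)
    = F 0 (Suc N) + F (Suc N) 0 + (\<Sum>(i, j)\<in>{(i, j). i + j = N + 1 \<and> i > 0 \<and> j > 0}. F i j)"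
proof -
  have fin: "finite {(i, j). i + j = N + 1 \<and> i > 0 \<and> j > 0}"
    by (rule finite_subset[OF _ finite_pairs[of "N + 1"]]) auto
  have "pairs (Suc N) = insert (0, Suc N) (insert (Suc N, 0) {(i, j). i + j = N + 1 \<and> i > 0 \<and> j > 0})"
    by auto
  then show ?thesis using fin by simp
qed

text \<open>Triples are sorted by their zero entries: two zeros give the three single terms, one
  zero gives three families indexed by positive pairs, and no zero gives the last sum. The families
  are grouped as in \<open>ob_mor\<close>, where the one with first index 0 stands apart.\<close>

lemma sum_triples_outer:
  fixes F :: "nat \<Rightarrow> nat \<Rightarrow> nat \<Rightarrow> 'a::ab_group_add"
  shows "(\<Sum>(i, j, k)\<in>triples (Suc N). F i j k)
    = F (Suc N) 0 0 + F 0 (Suc N) 0 + F 0 0 (Suc N)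
      + (\<Sum>(i, j)\<in>{(i, j). i + j = N + 1 \<and> i > 0 \<and> j > 0}. F i j 0 + F i 0 j)
      + (\<Sum>(i, j)\<in>{(i, j). i + j = N + 1 \<and> i > 0 \<and> j > 0}. F 0 i j)
      + (\<Sum>(i, j, k)\<in>{(i, j, k). i + j + k = N + 1 \<and> i > 0 \<and> j > 0 \<and> k > 0}. F i j k)"
proof -
  let ?P = "{(i, j). i + j = N + 1 \<and> i > 0 \<and> j > 0}"
  let ?Q = "{(i, j, k). i + j + k = N + 1 \<and> i > 0 \<and> j > 0 \<and> k > 0}"
  let ?X = "(\<lambda>(i, j). (i, j, 0)) ` ?P" and ?Y = "(\<lambda>(i, j). (i, 0, j)) ` ?P"
    and ?Z = "(\<lambda>(i, j). (0, i, j)) ` ?P"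
  let ?G = "\<lambda>(i, j, k). F i j k"
  have fin: "finite ?P"
    by (rule finite_subset[OF _ finite_pairs[of "N + 1"]]) auto
  have finQ: "finite ?Q"
    by (rule finite_subset[OF _ finite_triples[of "N + 1"]]) auto
  have T: "triples (Suc N) = insert (Suc N, 0, 0) (insert (0, Suc N, 0) (insert (0, 0, Suc N)
      (?X \<union> (?Y \<union> (?Z \<union> ?Q)))))"
    by (auto simp: image_iff)
  have dis: "?X \<inter> (?Y \<union> (?Z \<union> ?Q)) = {}" "?Y \<inter> (?Z \<union> ?Q) = {}" "?Z \<inter> ?Q = {}"
    by auto
  have "sum ?G (triples (Suc N)) = F (Suc N) 0 0 + (F 0 (Suc N) 0 + (F 0 0 (Suc N)
      + sum ?G (?X \<union> (?Y \<union> (?Z \<union> ?Q)))))"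
    unfolding T using fin finQ by (subst sum.insert, simp, force)+ simp
  also have "sum ?G (?X \<union> (?Y \<union> (?Z \<union> ?Q))) = sum ?G ?X + (sum ?G ?Y + (sum ?G ?Z + sum ?G ?Q))"
    using fin finQ dis by (simp only: sum.union_disjoint finite_UnI finite_imageI)
  also have "sum ?G ?X = (\<Sum>(i, j)\<in>?P. F i j 0)"
    by (subst sum.reindex) (auto simp: inj_on_def case_prod_unfold)
  also have "sum ?G ?Y = (\<Sum>(i, j)\<in>?P. F i 0 j)"
    by (subst sum.reindex) (auto simp: inj_on_def case_prod_unfold)
  also have "sum ?G ?Z = (\<Sum>(i, j)\<in>?P. F 0 i j)"
    by (subst sum.reindex) (auto simp: inj_on_def case_prod_unfold)
  finally show ?thesis
    by (simp add: case_prod_unfold sum.distrib algebra_simps)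
qed

section \<open>The pentagon identity for a family of products\<close>

definition associator ::
  "(nat \<Rightarrow> 'a \<Rightarrow> 'a \<Rightarrow> 'a::ab_group_add) \<Rightarrow> ('a \<Rightarrow> 'a) \<Rightarrow> nat \<Rightarrow> 'a \<Rightarrow> 'a \<Rightarrow> 'a \<Rightarrow> 'a" where
  "associator \<mu> \<alpha> n x y z
    = (\<Sum>(i, j)\<in>pairs n. \<mu> i (\<mu> j x y) (\<alpha> z) - \<mu> i (\<alpha> x) (\<mu> j y z))"

text \<open>This is the D_n of the introductory comment, the coefficient of t^n in the failure of
  multiplicativity; \<open>associator\<close> is the a_n there.\<close>

definition defect ::
  "(nat \<Rightarrow> 'a \<Rightarrow> 'a \<Rightarrow> 'a) \<Rightarrow> (nat \<Rightarrow> 'b \<Rightarrow> 'b \<Rightarrow> 'b::ab_group_add) \<Rightarrow> (nat \<Rightarrow> 'a \<Rightarrow> 'b) \<Rightarrow>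
     nat \<Rightarrow> 'a \<Rightarrow> 'a \<Rightarrow> 'b" where
  "defect \<mu> \<nu> f n x y =
     (\<Sum>(i, j, k)\<in>triples n. \<nu> i (f j x) (f k y)) - (\<Sum>(i, j)\<in>pairs n. f i (\<mu> j x y))"

text \<open>The identities below are cancellations between sums of iterated products in which no
  scalars occur, so they are stated for additive maps. \<open>twist_mult\<close> identifies products
  of twisted arguments with twisted products.\<close>

locale twisted_family =
  fixes \<mu> :: "nat \<Rightarrow> 'a::ab_group_add \<Rightarrow> 'a \<Rightarrow> 'a" and \<alpha> :: "'a \<Rightarrow> 'a"
  assumes additive_left: "additive (\<lambda>x. \<mu> i x y)"
    and additive_right: "additive (\<mu> i x)"
    and twist_mult: "\<alpha> (\<mu> i x y) = \<mu> i (\<alpha> x) (\<alpha> y)"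
begin

lemmas mult_sum2 = additive_sum_split2[OF additive_left] additive_sum_split2[OF additive_right]
lemmas mult_sum3 = additive_sum_split3[OF additive_left] additive_sum_split3[OF additive_right]
lemmas mult_diff = additive.diff[OF additive_left] additive.diff[OF additive_right]
lemmas mult_zero = additive.zero[OF additive_left] additive.zero[OF additive_right]

text \<open>Four factors have five bracketings, the vertices of a pentagon, and each of the five
  sums is the difference of two adjacent ones. Going round, every bracketing occurs twice with
  opposite signs.\<close>

lemma pentagon:
  "(\<Sum>(i, m)\<in>pairs n. \<mu> i (\<alpha> (\<alpha> x)) (associator \<mu> \<alpha> m y z w))
    - (\<Sum>(i, m)\<in>pairs n. associator \<mu> \<alpha> m (\<mu> i x y) (\<alpha> z) (\<alpha> w))
    + (\<Sum>(i, m)\<in>pairs n. associator \<mu> \<alpha> m (\<alpha> x) (\<mu> i y z) (\<alpha> w))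
    - (\<Sum>(i, m)\<in>pairs n. associator \<mu> \<alpha> m (\<alpha> x) (\<alpha> y) (\<mu> i z w))
    + (\<Sum>(i, m)\<in>pairs n. \<mu> i (associator \<mu> \<alpha> m x y z) (\<alpha> (\<alpha> w))) = 0"
proof -
  let ?a = "\<lambda>i j k. \<mu> i (\<alpha> (\<alpha> x)) (\<mu> j (\<mu> k y z) (\<alpha> w))"
  let ?b = "\<lambda>i j k. \<mu> i (\<alpha> (\<alpha> x)) (\<mu> j (\<alpha> y) (\<mu> k z w))"
  let ?c = "\<lambda>i j k. \<mu> i (\<mu> j (\<mu> k x y) (\<alpha> z)) (\<alpha> (\<alpha> w))"
  let ?d = "\<lambda>i j k. \<mu> i (\<mu> j (\<alpha> x) (\<alpha> y)) (\<mu> k (\<alpha> z) (\<alpha> w))"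
  let ?e = "\<lambda>i j k. \<mu> i (\<mu> j (\<alpha> x) (\<mu> k y z)) (\<alpha> (\<alpha> w))"
  let ?T = "\<lambda>F. \<Sum>(i, j, k)\<in>triples n. F i j k"
  note expand = associator_def mult_sum2 mult_diff sum_split sum_pairs_pairs twist_mult
  have 1: "(\<Sum>(i, m)\<in>pairs n. \<mu> i (\<alpha> (\<alpha> x)) (associator \<mu> \<alpha> m y z w)) = ?T ?a - ?T ?b"
    unfolding expand ..
  have 2: "(\<Sum>(i, m)\<in>pairs n. associator \<mu> \<alpha> m (\<mu> i x y) (\<alpha> z) (\<alpha> w)) = ?T ?c - ?T ?d"
    \<comment> \<open>The index \<open>i\<close> now belongs to an inner product, so the triples are
      permuted until the indices follow the order in \<open>?c\<close> and \<open>?d\<close>. The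
      same happens in the third and fourth sums.\<close>
    unfolding expand
    by (intro arg_cong2[of _ _ _ _ minus] trans[OF sum_triples_swap sum_triples_rotate]
      sum_triples_swap sum_triples_rotate[symmetric])
  have 3: "(\<Sum>(i, m)\<in>pairs n. associator \<mu> \<alpha> m (\<alpha> x) (\<mu> i y z) (\<alpha> w)) = ?T ?e - ?T ?a"
    unfolding expand
    by (intro arg_cong2[of _ _ _ _ minus] sum_triples_rotate[symmetric])
  have 4: "(\<Sum>(i, m)\<in>pairs n. associator \<mu> \<alpha> m (\<alpha> x) (\<alpha> y) (\<mu> i z w)) = ?T ?d - ?T ?b"
    unfolding expand
    by (intro arg_cong2[of _ _ _ _ minus] sum_triples_rotate[symmetric])
  have 5: "(\<Sum>(i, m)\<in>pairs n. \<mu> i (associator \<mu> \<alpha> m x y z) (\<alpha> (\<alpha> w))) = ?T ?c - ?T ?e"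
    unfolding expand ..
  show ?thesis
    unfolding 1 2 3 4 5 by simp
qed

text \<open>Each of the five sums reduces to its summand with \<open>i = 0\<close> and
  \<open>m = Suc N\<close>. For \<open>\<mu> 0\<close> the product of the algebra, the left side is
  the degree 3 differential of \<open>associator \<mu> \<alpha> (Suc N)\<close>.\<close>

lemma pentagon_top:
  assumes "\<And>m x y z. m \<le> N \<Longrightarrow> associator \<mu> \<alpha> m x y z = 0"
  shows "\<mu> 0 (\<alpha> (\<alpha> x)) (associator \<mu> \<alpha> (Suc N) y z w) - associator \<mu> \<alpha> (Suc N) (\<mu> 0 x y) (\<alpha> z) (\<alpha> w)
    + associator \<mu> \<alpha> (Suc N) (\<alpha> x) (\<mu> 0 y z) (\<alpha> w) - associator \<mu> \<alpha> (Suc N) (\<alpha> x) (\<alpha> y) (\<mu> 0 z w)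
    + \<mu> 0 (associator \<mu> \<alpha> (Suc N) x y z) (\<alpha> (\<alpha> w)) = 0"
  using pentagon[where n = "Suc N"] by (simp add: sum_pairs_top assms mult_zero)

text \<open>The boundary pairs contribute four terms, which together are minus the degree 2
  differential of \<open>\<mu> (Suc N)\<close>.\<close>

lemma associator_eq_ob:
  fixes A :: "('k, 'a) hom_alg"
  assumes "twist A = \<alpha>"
  shows "associator \<mu> \<alpha> (Suc N) x y z = ob_alg A N \<mu> x y z
    - (\<mu> 0 (\<alpha> x) (\<mu> (Suc N) y z) - \<mu> (Suc N) (\<mu> 0 x y) (\<alpha> z)
       + \<mu> (Suc N) (\<alpha> x) (\<mu> 0 y z) - \<mu> 0 (\<mu> (Suc N) x y) (\<alpha> z))"
  unfolding associator_def ob_alg_def assms sum_pairs_outer by (simp add: algebra_simps)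

end

section \<open>Maps between two families of products\<close>

locale twisted_family_map =
  source: twisted_family \<mu> \<alpha> + target: twisted_family \<nu> \<beta>
  for \<mu> :: "nat \<Rightarrow> 'a::ab_group_add \<Rightarrow> 'a \<Rightarrow> 'a" and \<alpha>
    and \<nu> :: "nat \<Rightarrow> 'b::ab_group_add \<Rightarrow> 'b \<Rightarrow> 'b" and \<beta> +
  fixes f :: "nat \<Rightarrow> 'a \<Rightarrow> 'b"
  assumes additive_map: "additive (f i)"
    and map_twist: "f i (\<alpha> x) = \<beta> (f i x)"
begin

lemmas map_sum = additive_sum_split2[OF additive_map]
lemmas map_diff = additive.diff[OF additive_map]
lemmas map_zero = additive.zero[OF additive_map]

text \<open>For either bracketing one passes from \<open>f\<close> of an iterated product to the
  iterated product of the images in two stages, each costing a defect: first at the outer product,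
  then at the inner one. The difference of the two fully expanded bracketings is the associator of
  the target.\<close>

lemma map_associator:
  "(\<Sum>(i, m)\<in>pairs n. f i (associator \<mu> \<alpha> m x y z))
    = (\<Sum>(m, i, j, k)\<in>quadruples n. associator \<nu> \<beta> m (f i x) (f j y) (f k z))
      + (\<Sum>(i, j, m)\<in>triples n. \<nu> i (f j (\<alpha> x)) (defect \<mu> \<nu> f m y z))
      - (\<Sum>(i, m)\<in>pairs n. defect \<mu> \<nu> f m (\<mu> i x y) (\<alpha> z))
      + (\<Sum>(i, m)\<in>pairs n. defect \<mu> \<nu> f m (\<alpha> x) (\<mu> i y z))
      - (\<Sum>(i, j, m)\<in>triples n. \<nu> i (defect \<mu> \<nu> f m x y) (f j (\<alpha> z)))"
proof -
  let ?Q5 = "\<lambda>F. \<Sum>(i, j, k, l, r)\<in>quintuples n. F i j k l r"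
  let ?Q4 = "\<lambda>F. \<Sum>(i, j, k, l)\<in>quadruples n. F i j k l"
  let ?T = "\<lambda>F. \<Sum>(i, j, k)\<in>triples n. F i j k"
  let ?L5 = "\<lambda>i j k l r. \<nu> i (\<nu> j (f k x) (f l y)) (f r (\<alpha> z))"
  let ?R5 = "\<lambda>i j k l r. \<nu> i (f j (\<alpha> x)) (\<nu> k (f l y) (f r z))"
  let ?L4 = "\<lambda>i j k l. \<nu> i (f j (\<mu> k x y)) (f l (\<alpha> z))"
  let ?R4 = "\<lambda>i j k l. \<nu> i (f j (\<alpha> x)) (f k (\<mu> l y z))"
  let ?L = "\<lambda>i j k. f i (\<mu> j (\<mu> k x y) (\<alpha> z))"
  let ?R = "\<lambda>i j k. f i (\<mu> j (\<alpha> x) (\<mu> k y z))"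
  \<comment> \<open>\<open>map_twist\<close> is reversed so that the twist of the target turns into
    \<open>\<alpha>\<close> on the argument of \<open>f\<close>, as in the defect sums.\<close>
  note expand = associator_def defect_def
    source.mult_sum2 source.mult_diff target.mult_sum2 target.mult_diff map_sum map_diff
    map_twist[symmetric] sum_split sum_pairs_pairs sum_pairs_triples sum_triples_pairs
    sum_triples_triples sum_quadruples_pairs
  have 0: "(\<Sum>(i, m)\<in>pairs n. f i (associator \<mu> \<alpha> m x y z)) = ?T ?L - ?T ?R"
    unfolding expand ..
  have 1: "(\<Sum>(m, i, j, k)\<in>quadruples n. associator \<nu> \<beta> m (f i x) (f j y) (f k z))
    = ?Q5 ?L5 - ?Q5 ?R5"
    unfolding expand
    \<comment> \<open>The first sums agree as they stand. In \<open>?R5\<close> the index of the map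
      applied to \<open>\<alpha> x\<close> precedes that of the inner product, hence the
      transposition of the second and third index.\<close>
    by (intro arg_cong2[of _ _ _ _ minus] refl
      sum.reindex_bij_witness[where i = "\<lambda>(i, j, k, l, r). (i, k, j, l, r)"
          and j = "\<lambda>(i, j, k, l, r). (i, k, j, l, r)"]) auto
  \<comment> \<open>The rule for sums over pairs also matches sums over triples, so those are expanded first.\<close>
  have 2: "(\<Sum>(i, j, m)\<in>triples n. \<nu> i (f j (\<alpha> x)) (defect \<mu> \<nu> f m y z)) = ?Q5 ?R5 - ?Q4 ?R4"
    unfolding defect_def target.mult_diff target.mult_sum3 sum_subtractf_split3
    unfolding expand ..
  have 3: "(\<Sum>(i, m)\<in>pairs n. defect \<mu> \<nu> f m (\<mu> i x y) (\<alpha> z)) = ?Q4 ?L4 - ?T ?L"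
    unfolding expand
    by (intro arg_cong2[of _ _ _ _ minus] sum_triples_rotate[symmetric]
      sum.reindex_bij_witness[where i = "\<lambda>(i, j, k, l). (k, i, j, l)"
          and j = "\<lambda>(k, i, j, l). (i, j, k, l)"]) auto
  have 4: "(\<Sum>(i, m)\<in>pairs n. defect \<mu> \<nu> f m (\<alpha> x) (\<mu> i y z)) = ?Q4 ?R4 - ?T ?R"
    unfolding expand
    by (intro arg_cong2[of _ _ _ _ minus] sum_triples_rotate[symmetric]
      sum.reindex_bij_witness[where i = "\<lambda>(i, j, k, l). (l, i, j, k)"
          and j = "\<lambda>(l, i, j, k). (i, j, k, l)"]) auto
  have 5: "(\<Sum>(i, j, m)\<in>triples n. \<nu> i (defect \<mu> \<nu> f m x y) (f j (\<alpha> z))) = ?Q5 ?L5 - ?Q4 ?L4"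
    unfolding defect_def target.mult_diff target.mult_sum3 sum_subtractf_split3
    unfolding expand
    by (rule arg_cong2[of _ _ _ _ minus];
      rule sum.reindex_bij_witness[where i = "\<lambda>(i, j, k, l, r). (i, r, j, k, l)"
          and j = "\<lambda>(i, r, j, k, l). (i, j, k, l, r)"]
        sum.reindex_bij_witness[where i = "\<lambda>(i, j, k, l). (i, l, j, k)"
            and j = "\<lambda>(i, l, j, k). (i, j, k, l)"]; auto)
  show ?thesis
    unfolding 0 1 2 3 4 5 by simp
qed

text \<open>Only the summands with all other indices 0 survive in degree \<open>Suc N\<close>. With
  \<open>f 0\<close> as the morphism this becomes the third component of the differential of the
  morphism complex in degree 3.\<close>

lemma map_associator_top:
  assumes "\<And>m x y z. m \<le> N \<Longrightarrow> associator \<mu> \<alpha> m x y z = 0"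
    and "\<And>m x y z. m \<le> N \<Longrightarrow> associator \<nu> \<beta> m x y z = 0"
    and "\<And>m x y. m \<le> N \<Longrightarrow> defect \<mu> \<nu> f m x y = 0"
  shows "f 0 (associator \<mu> \<alpha> (Suc N) x y z) - associator \<nu> \<beta> (Suc N) (f 0 x) (f 0 y) (f 0 z)
    - (\<nu> 0 (f 0 (\<alpha> x)) (defect \<mu> \<nu> f (Suc N) y z) - defect \<mu> \<nu> f (Suc N) (\<mu> 0 x y) (\<alpha> z)
       + defect \<mu> \<nu> f (Suc N) (\<alpha> x) (\<mu> 0 y z) - \<nu> 0 (defect \<mu> \<nu> f (Suc N) x y) (f 0 (\<alpha> z))) = 0"
  using map_associator[where n = "Suc N"]
  by (simp add: sum_pairs_top sum_triples_top sum_quadruples_top assms map_zero target.mult_zero)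

text \<open>The summands containing an index \<open>Suc N\<close> are three triples and two pairs;
  they form minus the third component of the degree 2 differential of the new coefficients. Triples
  with one zero or none give sums of \<open>ob_mor\<close>.\<close>

lemma defect_eq_ob:
  fixes B :: "('k, 'b) hom_alg"
  assumes "\<nu> 0 = mult B"
  shows "defect \<mu> \<nu> f (Suc N) x y = ob_mor B (f 0) N \<mu> \<nu> f x y
    - (f 0 (\<mu> (Suc N) x y) - \<nu> (Suc N) (f 0 x) (f 0 y)
       - (\<nu> 0 (f 0 x) (f (Suc N) y) - f (Suc N) (\<mu> 0 x y) + \<nu> 0 (f (Suc N) x) (f 0 y)))"
  unfolding defect_def ob_mor_def assms[symmetric] sum_pairs_outer sum_triples_outer
  by (simp add: algebra_simps)

end

section \<open>Closure properties of linear maps\<close>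

lemma linear_imp_additive:
  assumes "Vector_Spaces.linear s1 s2 f"
  shows "additive f"
  using assms by (simp add: Vector_Spaces.linear_iff additive_def)

lemma linear_comp:
  assumes "Vector_Spaces.linear s1 s2 f" "Vector_Spaces.linear s2 s3 g"
  shows "Vector_Spaces.linear s1 s3 (\<lambda>x. g (f x))"
  using assms by (simp add: Vector_Spaces.linear_iff)

lemma linear_zero:
  assumes "vector_space s1" "vector_space s2"
  shows "Vector_Spaces.linear s1 s2 (\<lambda>_. 0)"
proof -
  interpret s2: vector_space s2 by fact
  show ?thesis using assms by (simp add: Vector_Spaces.linear_iff)
qed

lemma linear_add:
  assumes "Vector_Spaces.linear s1 s2 f" "Vector_Spaces.linear s1 s2 g"
  shows "Vector_Spaces.linear s1 s2 (\<lambda>x. f x + g x)"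
  using assms by (simp add: Vector_Spaces.linear_iff algebra_simps vector_space.vector_space_assms)

lemma linear_diff:
  assumes "Vector_Spaces.linear s1 s2 f" "Vector_Spaces.linear s1 s2 g"
  shows "Vector_Spaces.linear s1 s2 (\<lambda>x. f x - g x)"
proof -
  interpret s2: vector_space s2 using assms(1) by (simp add: Vector_Spaces.linear_iff)
  show ?thesis using assms by (simp add: Vector_Spaces.linear_iff s2.scale_right_diff_distrib)
qed

lemma linear_sum:
  assumes "vector_space s1" "vector_space s2" "\<And>i. Vector_Spaces.linear s1 s2 (F i)"
  shows "Vector_Spaces.linear s1 s2 (\<lambda>x. \<Sum>i\<in>I. F i x)"
  by (induction I rule: infinite_finite_induct) (simp_all add: assms linear_zero linear_add)

lemma linear_sum_split2:
  assumes "vector_space s1" "vector_space s2" "\<And>i j. Vector_Spaces.linear s1 s2 (F i j)"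
  shows "Vector_Spaces.linear s1 s2 (\<lambda>x. \<Sum>(i, j)\<in>I. F i j x)"
  using linear_sum[OF assms(1,2), of "\<lambda>(i, j). F i j"] assms(3) by (simp add: case_prod_unfold)

lemma linear_sum_split3:
  assumes "vector_space s1" "vector_space s2" "\<And>i j k. Vector_Spaces.linear s1 s2 (F i j k)"
  shows "Vector_Spaces.linear s1 s2 (\<lambda>x. \<Sum>(i, j, k)\<in>I. F i j k x)"
  using linear_sum[OF assms(1,2), of "\<lambda>(i, j, k). F i j k"] assms(3) by (simp add: case_prod_unfold)

section \<open>Cochains of arity one to three as curried maps\<close>

lemma all_list_length_1: "(\<forall>us. length us = 1 \<longrightarrow> P us) \<longleftrightarrow> (\<forall>x. P [x])"
  by (auto simp: length_Suc_conv)

lemma all_list_length_2: "(\<forall>us. length us = 2 \<longrightarrow> P us) \<longleftrightarrow> (\<forall>x y. P [x, y])"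
  by (auto simp: length_Suc_conv numeral_2_eq_2)

lemma all_list_length_3: "(\<forall>us. length us = 3 \<longrightarrow> P us) \<longleftrightarrow> (\<forall>x y z. P [x, y, z])"
  by (auto simp: length_Suc_conv numeral_3_eq_3)

lemma all_less_2: "(\<forall>i. i < (2::nat) \<longrightarrow> P i) \<longleftrightarrow> P 0 \<and> P 1"
  by (auto simp: less_Suc_eq numeral_2_eq_2)

lemma all_less_3: "(\<forall>i. i < (3::nat) \<longrightarrow> P i) \<longleftrightarrow> P 0 \<and> P 1 \<and> P 2"
  by (auto simp: less_Suc_eq numeral_3_eq_3 numeral_2_eq_2)

text \<open>Vanishing on lists of other lengths is built into \<open>cochain1\<close>, so what
  remains is linearity and compatibility with the twists, read off on the entries. The same applies
  to \<open>cochain2\<close> and \<open>cochain3\<close>.\<close>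

lemma cochain1_in_hom_cochains_iff:
  "cochain1 f \<in> hom_cochains A B 1 \<longleftrightarrow>
     Vector_Spaces.linear (scal A) (scal B) f \<and> (\<forall>x. twist B (f x) = f (twist A x))"
proof -
  have "cochain1 f us = 0" if "length us \<noteq> 1" for us
    using that by (auto simp: cochain1_def split: list.split)
  moreover have "multilinear (scal A) (scal B) 1 (cochain1 f) \<longleftrightarrow> Vector_Spaces.linear (scal A) (scal B) f"
    \<comment> \<open>\<open>all_simps(6)\<close> moves the quantifier over positions below the
      length premise, which gives the shape that \<open>all_list_length_1\<close> rewrites.\<close>
    unfolding multilinear_def all_simps(6) all_list_length_1 by (simp add: cochain1_def)
  ultimately show ?thesis
    unfolding hom_cochains_def mem_Collect_eq all_list_length_1 by (simp add: cochain1_def)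
qed

lemma cochain2_in_hom_cochains_iff:
  "cochain2 f \<in> hom_cochains A B 2 \<longleftrightarrow>
     (\<forall>y. Vector_Spaces.linear (scal A) (scal B) (\<lambda>x. f x y)) \<and>
     (\<forall>x. Vector_Spaces.linear (scal A) (scal B) (f x)) \<and>
     (\<forall>x y. twist B (f x y) = f (twist A x) (twist A y))"
proof -
  have "cochain2 f us = 0" if "length us \<noteq> 2" for us
    using that by (auto simp: cochain2_def split: list.split)
  moreover have "multilinear (scal A) (scal B) 2 (cochain2 f) \<longleftrightarrow>
     (\<forall>y. Vector_Spaces.linear (scal A) (scal B) (\<lambda>x. f x y)) \<and>
     (\<forall>x. Vector_Spaces.linear (scal A) (scal B) (f x))"
    unfolding multilinear_def all_simps(6) all_list_length_2 all_less_2 by (simp add: cochain2_def all_conj_distrib)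
  ultimately show ?thesis
    unfolding hom_cochains_def mem_Collect_eq all_list_length_2 by (simp add: cochain2_def)
qed

lemma cochain3_in_hom_cochains_iff:
  "cochain3 f \<in> hom_cochains A B 3 \<longleftrightarrow>
     (\<forall>y z. Vector_Spaces.linear (scal A) (scal B) (\<lambda>x. f x y z)) \<and>
     (\<forall>x z. Vector_Spaces.linear (scal A) (scal B) (\<lambda>y. f x y z)) \<and>
     (\<forall>x y. Vector_Spaces.linear (scal A) (scal B) (f x y)) \<and>
     (\<forall>x y z. twist B (f x y z) = f (twist A x) (twist A y) (twist A z))"
proof -
  have "cochain3 f us = 0" if "length us \<noteq> 3" for us
    using that by (auto simp: cochain3_def split: list.split)
  moreover have "multilinear (scal A) (scal B) 3 (cochain3 f) \<longleftrightarrow>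
     (\<forall>y z. Vector_Spaces.linear (scal A) (scal B) (\<lambda>x. f x y z)) \<and>
     (\<forall>x z. Vector_Spaces.linear (scal A) (scal B) (\<lambda>y. f x y z)) \<and>
     (\<forall>x y. Vector_Spaces.linear (scal A) (scal B) (f x y))"
    unfolding multilinear_def all_simps(6) all_list_length_3 all_less_3
    by (simp add: cochain3_def all_conj_distrib numeral_2_eq_2)
  ultimately show ?thesis
    unfolding hom_cochains_def mem_Collect_eq all_list_length_3 by (simp add: cochain3_def)
qed

text \<open>A cochain is determined by its values on lists of the right length, being 0 elsewhere.
  This turns an arbitrary primitive of the obstruction into curried coefficients.\<close>

lemma hom_cochains_1_eq: "f \<in> hom_cochains A B 1 \<Longrightarrow> f = cochain1 (\<lambda>x. f [x])"
  by (auto simp: hom_cochains_def cochain1_def fun_eq_iff split: list.split)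

lemma hom_cochains_2_eq: "f \<in> hom_cochains A B 2 \<Longrightarrow> f = cochain2 (\<lambda>x y. f [x, y])"
  by (auto simp: hom_cochains_def cochain2_def fun_eq_iff split: list.split)

lemma cochain2_eq_iff: "cochain2 f = cochain2 g \<longleftrightarrow> (\<forall>x y. f x y = g x y)"
proof
  assume "cochain2 f = cochain2 g"
  then have "cochain2 f [x, y] = cochain2 g [x, y]" for x y by simp
  then show "\<forall>x y. f x y = g x y" by (simp add: cochain2_def)
qed (simp add: cochain2_def fun_eq_iff split: list.split)

lemma cochain3_eq_iff: "cochain3 f = cochain3 g \<longleftrightarrow> (\<forall>x y z. f x y z = g x y z)"
proof
  assume "cochain3 f = cochain3 g"
  then have "cochain3 f [x, y, z] = cochain3 g [x, y, z]" for x y z by simp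
  then show "\<forall>x y z. f x y z = g x y z" by (simp add: cochain3_def)
qed (simp add: cochain3_def fun_eq_iff split: list.split)

section \<open>The differential in low degrees\<close>

lemma scale_minus_one:
  assumes "vector_space s"
  shows "s (- 1) x = - x"
proof -
  interpret vector_space s by fact
  show ?thesis by (simp add: scale_minus_left)
qed

lemma scale_one:
  assumes "vector_space s"
  shows "s 1 x = x"
  using assms by (simp add: vector_space.vector_space_assms)

lemma hom_delta_cochain1:
  assumes "vector_space (scal B)"
  shows "hom_delta A B \<phi> 1 (cochain1 f) =
    cochain2 (\<lambda>x y. mult B (\<phi> x) (f y) - f (mult A x y) + mult B (f x) (\<phi> y))"
  by (auto simp: hom_delta_def cochain1_def cochain2_def fun_eq_iff scale_minus_one scale_one assms
      split: list.split)

text \<open>The twist next to \<open>\<phi>\<close> has exponent \<open>n - 1\<close>, hence 0, 1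
  and 2 in degrees 1, 2 and 3; the sign of the last term is positive, negative and positive
  there.\<close>

lemma hom_delta_cochain2:
  assumes "vector_space (scal B)"
  shows "hom_delta A B \<phi> 2 (cochain2 f) =
    cochain3 (\<lambda>x y z. mult B (\<phi> (twist A x)) (f y z) - f (mult A x y) (twist A z)
      + f (twist A x) (mult A y z) - mult B (f x y) (\<phi> (twist A z)))"
  by (auto simp: hom_delta_def cochain2_def cochain3_def fun_eq_iff scale_minus_one scale_one assms
      numeral_2_eq_2 sum.atLeast_Suc_atMost split: list.split)

lemma hom_delta_cochain3:
  assumes "vector_space (scal B)"
  shows "hom_delta A B \<phi> 3 (cochain3 f) [x, y, z, w] =
    mult B (\<phi> (twist A (twist A x))) (f y z w) - f (mult A x y) (twist A z) (twist A w)
      + f (twist A x) (mult A y z) (twist A w) - f (twist A x) (twist A y) (mult A z w)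
      + mult B (f x y z) (\<phi> (twist A (twist A w)))"
  by (auto simp: hom_delta_def cochain3_def scale_minus_one scale_one assms
      numeral_3_eq_3 sum.atLeast_Suc_atMost numeral_2_eq_2 split: list.split)

text \<open>\<open>hom_delta\<close> is 0 by definition on lists of the wrong length, so four
  entries suffice as a test.\<close>

lemma hom_delta_cochain3_eq_0_iff:
  "hom_delta A B \<phi> 3 f = (\<lambda>_. 0) \<longleftrightarrow> (\<forall>x y z w. hom_delta A B \<phi> 3 f [x, y, z, w] = 0)"
proof
  assume *: "\<forall>x y z w. hom_delta A B \<phi> 3 f [x, y, z, w] = 0"
  show "hom_delta A B \<phi> 3 f = (\<lambda>_. 0)"
  proof
    fix xs
    show "hom_delta A B \<phi> 3 f xs = 0"
    proof (cases "length xs = 4")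
      case True
      then obtain x y z w where "xs = [x, y, z, w]"
        by (auto simp: length_Suc_conv eval_nat_numeral)
      with * show ?thesis by simp
    qed (simp add: hom_delta_def)
  qed
qed simp

section \<open>The obstruction consists of cochains\<close>

lemma ob_alg_in_hom_cochains:
  assumes A: "vector_space (scal A)" "Vector_Spaces.linear (scal A) (scal A) (twist A)"
    and \<mu>: "\<And>i. cochain2 (\<mu> i) \<in> hom_cochains A A 2"
  shows "cochain3 (ob_alg A N \<mu>) \<in> hom_cochains A A 3"
proof -
  have l: "Vector_Spaces.linear (scal A) (scal A) (\<lambda>x. \<mu> i x y)"
    and r: "Vector_Spaces.linear (scal A) (scal A) (\<mu> i y)"
    and t: "twist A (\<mu> i x y) = \<mu> i (twist A x) (twist A y)" for i x y
    using \<mu>[of i] by (auto simp: cochain2_in_hom_cochains_iff)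
  note add = linear_imp_additive[OF A(2)]
  note comps = linear_comp[OF l l] linear_comp[OF l r] linear_comp[OF r l] linear_comp[OF r r]
    linear_comp[OF A(2) l] linear_comp[OF A(2) r]
  show ?thesis
    unfolding cochain3_in_hom_cochains_iff ob_alg_def
  proof (intro conjI allI)
    fix x y z
    show "twist A (\<Sum>(p, q) \<in> {(p, q). p + q = N + 1 \<and> p > 0 \<and> q > 0}.
        \<mu> p (\<mu> q x y) (twist A z) - \<mu> p (twist A x) (\<mu> q y z)) =
      (\<Sum>(p, q) \<in> {(p, q). p + q = N + 1 \<and> p > 0 \<and> q > 0}.
        \<mu> p (\<mu> q (twist A x) (twist A y)) (twist A (twist A z))
          - \<mu> p (twist A (twist A x)) (\<mu> q (twist A y) (twist A z)))"
      by (simp add: additive_sum_split2[OF add] additive.diff[OF add] t)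
  qed (intro linear_sum_split2 linear_diff A comps)+
qed

lemma ob_mor_in_hom_cochains:
  assumes A: "vector_space (scal A)"
    and B: "vector_space (scal B)" "Vector_Spaces.linear (scal B) (scal B) (twist B)"
    and \<mu>: "\<And>i. cochain2 (\<mu> i) \<in> hom_cochains A A 2"
    and \<nu>: "\<And>i. cochain2 (\<nu> i) \<in> hom_cochains B B 2" "\<nu> 0 = mult B"
    and f: "\<And>i. cochain1 (f i) \<in> hom_cochains A B 1"
  shows "cochain2 (ob_mor B (f 0) N \<mu> \<nu> f) \<in> hom_cochains A B 2"
proof -
  have l: "Vector_Spaces.linear (scal A) (scal A) (\<lambda>x. \<mu> i x y)"
    and r: "Vector_Spaces.linear (scal A) (scal A) (\<mu> i y)"
    and t: "twist A (\<mu> i x y) = \<mu> i (twist A x) (twist A y)" for i x y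
    using \<mu>[of i] by (auto simp: cochain2_in_hom_cochains_iff)
  have l': "Vector_Spaces.linear (scal B) (scal B) (\<lambda>x. \<nu> i x y)"
    and r': "Vector_Spaces.linear (scal B) (scal B) (\<nu> i y)"
    and t': "twist B (\<nu> i x y) = \<nu> i (twist B x) (twist B y)" for i x y
    using \<nu>(1)[of i] by (auto simp: cochain2_in_hom_cochains_iff)
  have f: "Vector_Spaces.linear (scal A) (scal B) (f i)"
    and ft: "twist B (f i x) = f i (twist A x)" for i x
    using f[of i] unfolding cochain1_in_hom_cochains_iff by auto
  note add = linear_imp_additive[OF B(2)]
  note comps = linear_comp[OF f l'] linear_comp[OF f r'] linear_comp[OF l f] linear_comp[OF r f]
  show ?thesis
    \<comment> \<open>Writing \<open>mult B\<close> as \<open>\<nu> 0\<close> brings every term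
      under the rules for the coefficients \<open>\<nu> i\<close>.\<close>
    unfolding cochain2_in_hom_cochains_iff ob_mor_def \<nu>(2)[symmetric]
    by (intro conjI allI; (intro linear_sum_split2 linear_sum_split3 linear_diff linear_add A B comps)?;
      simp add: additive.sum[OF add] case_prod_unfold additive.diff[OF add]
        additive.add[OF add] t t' ft)
qed

section \<open>Deformation equations as vanishing of associators and defects\<close>

lemma twisted_family_if_cochains:
  assumes "\<And>i. cochain2 (\<mu> i) \<in> hom_cochains A A 2"
  shows "twisted_family \<mu> (twist A)"
  using assms unfolding cochain2_in_hom_cochains_iff twisted_family_def
  by (metis linear_imp_additive)

lemma twisted_family_map_if_cochains:
  assumes "\<And>i. cochain2 (\<mu> i) \<in> hom_cochains A A 2" "\<And>i. cochain2 (\<nu> i) \<in> hom_cochains B B 2"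
    and "\<And>i. cochain1 (f i) \<in> hom_cochains A B 1"
  shows "twisted_family_map \<mu> (twist A) \<nu> (twist B) f"
  using assms(1,2) assms(3)[unfolded cochain1_in_hom_cochains_iff]
  by (auto simp: twisted_family_map_def twisted_family_map_axioms_def
      intro: linear_imp_additive twisted_family_if_cochains)

lemma sum_upto_eq_sum_pairs: "(\<Sum>i = 0..n. F i (n - i)) = (\<Sum>(i, j)\<in>pairs n. F i j)"
  by (rule sum.reindex_bij_witness[where i = fst and j = "\<lambda>i. (i, n - i)"]) auto

lemma deformation_of_order_iff:
  "deformation_of_order A B \<phi> N \<mu>A \<mu>B \<phi>s \<longleftrightarrow>
     \<mu>A 0 = mult A \<and> \<mu>B 0 = mult B \<and> \<phi>s 0 = \<phi> \<and>
     (\<forall>i\<le>N. cochain2 (\<mu>A i) \<in> hom_cochains A A 2 \<and> cochain2 (\<mu>B i) \<in> hom_cochains B B 2 \<and>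
        cochain1 (\<phi>s i) \<in> hom_cochains A B 1) \<and>
     (\<forall>i>N. \<mu>A i = (\<lambda>_ _. 0) \<and> \<mu>B i = (\<lambda>_ _. 0) \<and> \<phi>s i = (\<lambda>_. 0)) \<and>
     (\<forall>n\<le>N. (\<forall>x y z. associator \<mu>A (twist A) n x y z = 0) \<and>
        (\<forall>x y z. associator \<mu>B (twist B) n x y z = 0) \<and> (\<forall>x y. defect \<mu>A \<mu>B \<phi>s n x y = 0))"
  unfolding deformation_of_order_def associator_def defect_def
    sum_upto_eq_sum_pairs[where F = "\<lambda>i j. \<phi>s i (\<mu>A j _ _)"] right_minus_eq
  \<comment> \<open>The multiplicativity equation of a deformation has the sum over pairs on the
    left, whereas \<open>defect\<close> subtracts it from the sum over triples; the two sides are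
    exchanged to match.\<close>
  by (simp only: eq_commute[of "sum _ (pairs _)" "sum _ (triples _)"])

lemma associator_cong:
  assumes "\<And>i. i \<le> n \<Longrightarrow> \<mu> i = \<mu>' i"
  shows "associator \<mu> \<alpha> n x y z = associator \<mu>' \<alpha> n x y z"
  unfolding associator_def using assms by (auto intro!: sum.cong)

lemma defect_cong:
  assumes "\<And>i. i \<le> n \<Longrightarrow> \<mu> i = \<mu>' i" "\<And>i. i \<le> n \<Longrightarrow> \<nu> i = \<nu>' i" "\<And>i. i \<le> n \<Longrightarrow> f i = f' i"
  shows "defect \<mu> \<nu> f n x y = defect \<mu>' \<nu>' f' n x y"
  unfolding defect_def using assms by (auto intro!: sum.cong arg_cong2[of _ _ _ _ minus])

text \<open>Two positive indices with sum \<open>N + 1\<close> are both at most \<open>N\<close>.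
  Hence a new coefficient of index \<open>N + 1\<close> leaves the obstruction unchanged; likewise
  for \<open>ob_mor\<close>.\<close>

lemma ob_alg_cong:
  assumes "\<And>i. i \<le> N \<Longrightarrow> \<mu> i = \<mu>' i"
  shows "ob_alg A N \<mu> x y z = ob_alg A N \<mu>' x y z"
  unfolding ob_alg_def using assms by (auto intro!: sum.cong)

lemma ob_mor_cong:
  assumes "\<And>i. i \<le> N \<Longrightarrow> \<mu> i = \<mu>' i" "\<And>i. i \<le> N \<Longrightarrow> \<nu> i = \<nu>' i" "\<And>i. i \<le> N \<Longrightarrow> f i = f' i"
  shows "ob_mor B \<phi> N \<mu> \<nu> f x y = ob_mor B \<phi> N \<mu>' \<nu>' f' x y"
  unfolding ob_mor_def using assms
  by (auto intro!: sum.cong arg_cong2[of _ _ _ _ minus] arg_cong2[of _ _ _ _ plus])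

section \<open>The differential of the morphism complex in degrees two and three\<close>

lemma mor_delta_2:
  assumes "vector_space (scal A)" "vector_space (scal B)" "\<phi> 0 = 0"
  shows "mor_delta A B \<phi> 2 (cochain2 a, cochain2 b, cochain1 \<psi>) =
    (cochain3 (\<lambda>x y z. mult A (twist A x) (a y z) - a (mult A x y) (twist A z)
       + a (twist A x) (mult A y z) - mult A (a x y) (twist A z)),
     cochain3 (\<lambda>x y z. mult B (twist B x) (b y z) - b (mult B x y) (twist B z)
       + b (twist B x) (mult B y z) - mult B (b x y) (twist B z)),
     cochain2 (\<lambda>x y. \<phi> (a x y) - b (\<phi> x) (\<phi> y)
       - (mult B (\<phi> x) (\<psi> y) - \<psi> (mult A x y) + mult B (\<psi> x) (\<phi> y))))"
proof -
  have "hom_delta A B \<phi> (2 - 1) (cochain1 \<psi>) =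
      cochain2 (\<lambda>x y. mult B (\<phi> x) (\<psi> y) - \<psi> (mult A x y) + mult B (\<psi> x) (\<phi> y))"
    using hom_delta_cochain1[OF assms(2)] by simp
  \<comment> \<open>\<open>\<phi> 0 = 0\<close> makes the third component vanish on lists of the
    wrong length, where \<open>\<phi>\<close> is applied to the default value of a cochain.\<close>
  then show ?thesis
    by (auto simp: mor_delta_def hom_delta_cochain2 assms cochain2_def fun_eq_iff split: list.split)
qed

text \<open>The three conditions are in the form in which \<open>pentagon_top\<close>, for both
  algebras, and \<open>map_associator_top\<close> deliver them.\<close>

lemma mor_delta_3_eq_0:
  assumes "vector_space (scal A)" "vector_space (scal B)" "\<phi> 0 = 0"
    and a: "\<And>x y z w. mult A (twist A (twist A x)) (a y z w) - a (mult A x y) (twist A z) (twist A w)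
      + a (twist A x) (mult A y z) (twist A w) - a (twist A x) (twist A y) (mult A z w)
      + mult A (a x y z) (twist A (twist A w)) = 0"
    and b: "\<And>x y z w. mult B (twist B (twist B x)) (b y z w) - b (mult B x y) (twist B z) (twist B w)
      + b (twist B x) (mult B y z) (twist B w) - b (twist B x) (twist B y) (mult B z w)
      + mult B (b x y z) (twist B (twist B w)) = 0"
    and d: "\<And>x y z. \<phi> (a x y z) - b (\<phi> x) (\<phi> y) (\<phi> z)
      - (mult B (\<phi> (twist A x)) (d y z) - d (mult A x y) (twist A z)
         + d (twist A x) (mult A y z) - mult B (d x y) (\<phi> (twist A z))) = 0"
  shows "mor_delta A B \<phi> 3 (cochain3 a, cochain3 b, cochain2 d) = (\<lambda>_. 0, \<lambda>_. 0, \<lambda>_. 0)"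
proof -
  have "hom_delta A A id 3 (cochain3 a) = (\<lambda>_. 0)" "hom_delta B B id 3 (cochain3 b) = (\<lambda>_. 0)"
    using a b by (simp_all add: hom_delta_cochain3_eq_0_iff hom_delta_cochain3 assms(1,2))
  moreover have "hom_delta A B \<phi> (3 - 1) (cochain2 d) =
      cochain3 (\<lambda>x y z. mult B (\<phi> (twist A x)) (d y z) - d (mult A x y) (twist A z)
        + d (twist A x) (mult A y z) - mult B (d x y) (\<phi> (twist A z)))"
    using hom_delta_cochain2[OF assms(2)] by simp
  ultimately show ?thesis
    using d by (simp add: mor_delta_def cochain3_def fun_eq_iff assms(3) split: list.split)
qed

section \<open>The cocycle property and the extension criterion\<close>

lemma obstruction_in_mor_cocycles:
  fixes A :: "('k::field, 'a::ab_group_add) hom_alg" and B :: "('k, 'b::ab_group_add) hom_alg"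
  assumes A: "hom_associative A" and B: "hom_associative B" and \<phi>: "hom_alg_morphism A B \<phi>"
    and cochains: "\<And>i. cochain2 (\<mu>A i) \<in> hom_cochains A A 2"
      "\<And>i. cochain2 (\<mu>B i) \<in> hom_cochains B B 2" "\<And>i. cochain1 (\<phi>s i) \<in> hom_cochains A B 1"
    and def: "deformation_of_order A B \<phi> N \<mu>A \<mu>B \<phi>s"
  shows "obstruction A B \<phi> N \<mu>A \<mu>B \<phi>s \<in> mor_cocycles A B \<phi> 3"
proof -
  interpret twisted_family_map \<mu>A "twist A" \<mu>B "twist B" \<phi>s
    by (rule twisted_family_map_if_cochains[OF cochains])
  have vs: "vector_space (scal A)" "vector_space (scal B)"
    and lin: "Vector_Spaces.linear (scal A) (scal A) (twist A)"
      "Vector_Spaces.linear (scal B) (scal B) (twist B)"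
    using A B by (auto simp: hom_associative_def)
  have \<phi>0: "\<phi> 0 = 0"
    using \<phi> by (auto simp: hom_alg_morphism_def intro: additive.zero linear_imp_additive)
  note D = def[unfolded deformation_of_order_iff]
  have zero: "\<mu>A 0 = mult A" "\<mu>B 0 = mult B" "\<phi>s 0 = \<phi>" using D by auto
  have top: "\<mu>A (Suc N) = (\<lambda>_ _. 0)" "\<mu>B (Suc N) = (\<lambda>_ _. 0)" "\<phi>s (Suc N) = (\<lambda>_. 0)" using D by auto
  have van: "associator \<mu>A (twist A) m x y z = 0" "associator \<mu>B (twist B) m x' y' z' = 0"
    "defect \<mu>A \<mu>B \<phi>s m x y = 0" if "m \<le> N" for m x y z x' y' z'
    using D that by auto
  \<comment> \<open>The coefficients of index \<open>Suc N\<close> are zero here, so the coboundary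
    terms separating obstruction and associator or defect disappear.\<close>
  have obA: "ob_alg A N \<mu>A = associator \<mu>A (twist A) (Suc N)"
    by (intro ext) (simp add: source.associator_eq_ob[OF refl] top source.mult_zero)
  have obB: "ob_alg B N \<mu>B = associator \<mu>B (twist B) (Suc N)"
    by (intro ext) (simp add: target.associator_eq_ob[OF refl] top target.mult_zero)
  have obm: "ob_mor B \<phi> N \<mu>A \<mu>B \<phi>s = defect \<mu>A \<mu>B \<phi>s (Suc N)"
    by (intro ext) (simp add: defect_eq_ob[OF zero(2)] top target.mult_zero map_zero flip: zero(3))
  have "mor_delta A B \<phi> 3 (obstruction A B \<phi> N \<mu>A \<mu>B \<phi>s) = (\<lambda>_. 0, \<lambda>_. 0, \<lambda>_. 0)"
    unfolding obstruction_def obA obB obm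
    by (rule mor_delta_3_eq_0[OF vs \<phi>0 source.pentagon_top[OF van(1), unfolded zero]
        target.pentagon_top[OF van(2), unfolded zero] map_associator_top[OF van, unfolded zero]])
  moreover have "obstruction A B \<phi> N \<mu>A \<mu>B \<phi>s \<in> mor_cochains A B 3"
    using ob_alg_in_hom_cochains[OF vs(1) lin(1) cochains(1), of N]
      ob_alg_in_hom_cochains[OF vs(2) lin(2) cochains(2), of N]
      ob_mor_in_hom_cochains[where f = \<phi>s and \<mu> = \<mu>A and \<nu> = \<mu>B,
        OF vs lin(2) cochains(1) cochains(2) zero(2) cochains(3), of N]
    by (simp add: obstruction_def mor_cochains_def zero)
  ultimately show ?thesis
    by (simp add: mor_cocycles_def)
qed

text \<open>Equations of degree up to \<open>N\<close> are inherited, and the three equations of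
  degree \<open>N + 1\<close> say that the obstruction minus the differential of the new
  coefficients is 0 in each component.\<close>

lemma deformation_extended_by_iff:
  fixes A :: "('k::field, 'a::ab_group_add) hom_alg" and B :: "('k, 'b::ab_group_add) hom_alg"
  assumes A: "hom_associative A" and B: "hom_associative B" and \<phi>: "hom_alg_morphism A B \<phi>"
    and cochains: "\<And>i. cochain2 (\<mu>A i) \<in> hom_cochains A A 2"
      "\<And>i. cochain2 (\<mu>B i) \<in> hom_cochains B B 2" "\<And>i. cochain1 (\<phi>s i) \<in> hom_cochains A B 1"
    and def: "deformation_of_order A B \<phi> N \<mu>A \<mu>B \<phi>s"
    and new: "(cochain2 a, cochain2 b, cochain1 \<psi>) \<in> mor_cochains A B 2"
  shows "deformation_of_order A B \<phi> (N + 1) (\<mu>A(N + 1 := a)) (\<mu>B(N + 1 := b)) (\<phi>s(N + 1 := \<psi>))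
    \<longleftrightarrow> obstruction A B \<phi> N \<mu>A \<mu>B \<phi>s = mor_delta A B \<phi> 2 (cochain2 a, cochain2 b, cochain1 \<psi>)"
proof -
  let ?A = "\<mu>A(N + 1 := a)" and ?B = "\<mu>B(N + 1 := b)" and ?\<phi> = "\<phi>s(N + 1 := \<psi>)"
  have cochains': "cochain2 (?A i) \<in> hom_cochains A A 2" "cochain2 (?B i) \<in> hom_cochains B B 2"
    "cochain1 (?\<phi> i) \<in> hom_cochains A B 1" for i
    using cochains[of i] new by (auto simp: mor_cochains_def)
  interpret twisted_family_map ?A "twist A" ?B "twist B" ?\<phi>
    by (rule twisted_family_map_if_cochains[OF cochains'])
  have vs: "vector_space (scal A)" "vector_space (scal B)"
    using A B by (auto simp: hom_associative_def)
  have \<phi>0: "\<phi> 0 = 0"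
    using \<phi> by (auto simp: hom_alg_morphism_def intro: additive.zero linear_imp_additive)
  note D = def[unfolded deformation_of_order_iff]
  have zero: "\<mu>A 0 = mult A" "\<mu>B 0 = mult B" "\<phi>s 0 = \<phi>" using D by auto
  \<comment> \<open>The coefficients of degree \<open>n\<close> involve indices at most
    \<open>n\<close>, which the update at \<open>N + 1\<close> does not touch.\<close>
  have "associator ?A (twist A) n x y z = 0" "associator ?B (twist B) n x' y' z' = 0"
    "defect ?A ?B ?\<phi> n x y = 0" if "n \<le> N" for n x y z x' y' z'
    using D that associator_cong[of n ?A \<mu>A] associator_cong[of n ?B \<mu>B]
      defect_cong[of n ?A \<mu>A ?B \<mu>B ?\<phi> \<phi>s] by auto
  then have "deformation_of_order A B \<phi> (N + 1) ?A ?B ?\<phi> \<longleftrightarrow>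
      (\<forall>x y z. associator ?A (twist A) (Suc N) x y z = 0) \<and>
      (\<forall>x y z. associator ?B (twist B) (Suc N) x y z = 0) \<and> (\<forall>x y. defect ?A ?B ?\<phi> (Suc N) x y = 0)"
    unfolding deformation_of_order_iff using cochains' D by (auto simp: le_Suc_eq)
  also have "\<dots> \<longleftrightarrow> obstruction A B \<phi> N \<mu>A \<mu>B \<phi>s = mor_delta A B \<phi> 2 (cochain2 a, cochain2 b, cochain1 \<psi>)"
  proof -
    have "ob_alg A N ?A x y z = ob_alg A N \<mu>A x y z" for x y z
      by (rule ob_alg_cong) simp
    then have eqA: "associator ?A (twist A) (Suc N) x y z = ob_alg A N \<mu>A x y z
        - (mult A (twist A x) (a y z) - a (mult A x y) (twist A z)
           + a (twist A x) (mult A y z) - mult A (a x y) (twist A z))" for x y z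
      unfolding source.associator_eq_ob[OF refl] by (simp add: zero)
    have "ob_alg B N ?B x y z = ob_alg B N \<mu>B x y z" for x y z
      by (rule ob_alg_cong) simp
    then have eqB: "associator ?B (twist B) (Suc N) x y z = ob_alg B N \<mu>B x y z
        - (mult B (twist B x) (b y z) - b (mult B x y) (twist B z)
           + b (twist B x) (mult B y z) - mult B (b x y) (twist B z))" for x y z
      unfolding target.associator_eq_ob[OF refl] by (simp add: zero)
    have B0: "?B 0 = mult B" using zero by simp
    have "ob_mor B \<phi> N ?A ?B ?\<phi> x y = ob_mor B \<phi> N \<mu>A \<mu>B \<phi>s x y" for x y
      by (rule ob_mor_cong) simp_all
    then have eqD: "defect ?A ?B ?\<phi> (Suc N) x y = ob_mor B \<phi> N \<mu>A \<mu>B \<phi>s x y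
        - (\<phi> (a x y) - b (\<phi> x) (\<phi> y)
           - (mult B (\<phi> x) (\<psi> y) - \<psi> (mult A x y) + mult B (\<psi> x) (\<phi> y)))" for x y
      unfolding defect_eq_ob[OF B0] by (simp add: zero)
    show ?thesis
      unfolding obstruction_def mor_delta_2[where \<phi> = \<phi>, OF vs \<phi>0] prod.inject
        cochain2_eq_iff cochain3_eq_iff eqA eqB eqD right_minus_eq ..
  qed
  finally show ?thesis .
qed

theorem theorem4p8:
  fixes A :: "('k::{alg_closed_field, field_char_0}, 'a::ab_group_add) hom_alg"
    and B :: "('k, 'b::ab_group_add) hom_alg"
    and \<phi> :: "'a \<Rightarrow> 'b"
    and N :: nat
    and \<mu>A :: "nat \<Rightarrow> 'a \<Rightarrow> 'a \<Rightarrow> 'a"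
    and \<mu>B :: "nat \<Rightarrow> 'b \<Rightarrow> 'b \<Rightarrow> 'b"
    and \<phi>s :: "nat \<Rightarrow> 'a \<Rightarrow> 'b"
  assumes "hom_associative A" and "multiplicative A"
    and "hom_associative B" and "multiplicative B"
    and "hom_alg_morphism A B \<phi>"
    and "N \<ge> 1"
    and "deformation_of_order A B \<phi> N \<mu>A \<mu>B \<phi>s"
  shows "obstruction A B \<phi> N \<mu>A \<mu>B \<phi>s \<in> mor_cocycles A B \<phi> 3 \<and>
    (extends_to_next_order A B \<phi> N \<mu>A \<mu>B \<phi>s \<longleftrightarrow>
       obstruction A B \<phi> N \<mu>A \<mu>B \<phi>s \<in> mor_coboundaries A B \<phi> 3)"
proof -
  have vs: "vector_space (scal A)" "vector_space (scal B)"
    and lin: "Vector_Spaces.linear (scal A) (scal A) (twist A)"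
      "Vector_Spaces.linear (scal B) (scal B) (twist B)"
    using assms(1,3) by (auto simp: hom_associative_def)
  have t0: "twist A 0 = 0" "twist B 0 = 0"
    using lin by (auto intro: additive.zero linear_imp_additive)
  \<comment> \<open>Above \<open>N\<close> the coefficients are zero maps. These are cochains as
    well, since the twists fix 0, so membership extends to every index.\<close>
  have cochains: "cochain2 (\<mu>A i) \<in> hom_cochains A A 2" "cochain2 (\<mu>B i) \<in> hom_cochains B B 2"
    "cochain1 (\<phi>s i) \<in> hom_cochains A B 1" for i
    using assms(7)[unfolded deformation_of_order_iff] vs t0
    \<comment> \<open>\<open>simplified\<close> puts the arity 1 into the form \<open>Suc 0\<close>
      that the simplifier gives it in the goal.\<close>
    by (cases "i \<le> N";
        auto simp: cochain2_in_hom_cochains_iff cochain1_in_hom_cochains_iff[simplified] linear_zero not_le)+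
  note ext = deformation_extended_by_iff[OF assms(1,3,5) cochains assms(7)]
  have "extends_to_next_order A B \<phi> N \<mu>A \<mu>B \<phi>s \<longleftrightarrow>
      (\<exists>c \<in> mor_cochains A B 2. obstruction A B \<phi> N \<mu>A \<mu>B \<phi>s = mor_delta A B \<phi> 2 c)"
  proof
    assume "\<exists>c \<in> mor_cochains A B 2. obstruction A B \<phi> N \<mu>A \<mu>B \<phi>s = mor_delta A B \<phi> 2 c"
    then obtain f\<^sub>1 f\<^sub>2 f\<^sub>3 where c: "(f\<^sub>1, f\<^sub>2, f\<^sub>3) \<in> mor_cochains A B 2"
      "obstruction A B \<phi> N \<mu>A \<mu>B \<phi>s = mor_delta A B \<phi> 2 (f\<^sub>1, f\<^sub>2, f\<^sub>3)" by auto
    \<comment> \<open>A primitive consists of functions on lists, while an extension asks for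
      curried maps; evaluating on lists of entries supplies the witnesses.\<close>
    then have "f\<^sub>1 = cochain2 (\<lambda>x y. f\<^sub>1 [x, y])" "f\<^sub>2 = cochain2 (\<lambda>x y. f\<^sub>2 [x, y])"
      "f\<^sub>3 = cochain1 (\<lambda>x. f\<^sub>3 [x])"
      by (auto simp: mor_cochains_def intro: hom_cochains_2_eq hom_cochains_1_eq)
    with c ext show "extends_to_next_order A B \<phi> N \<mu>A \<mu>B \<phi>s"
      unfolding extends_to_next_order_def by metis
  next
    assume "extends_to_next_order A B \<phi> N \<mu>A \<mu>B \<phi>s"
    then show "\<exists>c \<in> mor_cochains A B 2. obstruction A B \<phi> N \<mu>A \<mu>B \<phi>s = mor_delta A B \<phi> 2 c"
      unfolding extends_to_next_order_def using ext by blast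
  qed
  then show ?thesis
    using obstruction_in_mor_cocycles[OF assms(1,3,5) cochains assms(7)]
    by (auto simp: mor_coboundaries_def)
qed

end
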